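(* Any streaming algorithm for \textsc{Connectivity} in the VA model that works on a family of graphs including all interval graphs and uses $p$ passes over the stream requires $\Omega(n/p)$ bits of memory on $n$-vertex graphs.
   Context: An interval graph is the intersection graph of a finite family of intervals on the real line. \textsc{Connectivity}: decide whether the graph is connected. In the Vertex Arrival (VA) streaming model, vertices arrive one by one in arbitrary fixed order and each edge is revealed when the later of its two endpoints arrives. A $p$-pass algorithm reads the stream $p$ times with unlimited computation; memory is in bits. "Requires $\Omega(f)$ bits" means there is a constant $c>0$ such that every such algorithm uses at least $cf$ bits on some $n$-vertex input of the class, for all sufficiently large $n$ and all $p$. *)

theory Defs
  imports
    "HOL-Analysis.Topology_Euclidean_Space"
    "HOL-Library.Sublist"
    "Graph_Theory.Graph_Theory"
begin

text \<open>
  A finite simple undirected graph is a \<open>pair_graph\<close> (finite, loop-free, symmetric arc relation, no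
  parallel arcs).  An \<open>n\<close>-vertex input graph has its vertices named \<open>0, \<dots>, n - 1\<close>; the names carry no
  information about the order of arrival.  The null graph is not an input, so that no convention
  about its connectivity matters.
\<close>

definition input_graph :: "nat pair_pre_digraph \<Rightarrow> bool" where
  "input_graph G \<longleftrightarrow> pair_graph G \<and> (\<exists>n>0. pverts G = {..<n})"

definition interval_graph :: "'a pair_pre_digraph \<Rightarrow> bool" where
  "interval_graph G \<longleftrightarrow> finite (pverts G) \<and>
     (\<exists>I :: 'a \<Rightarrow> real set.
        (\<forall>v\<in>pverts G. is_interval (I v) \<and> I v \<noteq> {}) \<and>
        parcs G = {(u, v). u \<in> pverts G \<and> v \<in> pverts G \<and> u \<noteq> v \<and> I u \<inter> I v \<noteq> {}})"

definition arrival_order :: "'a pair_pre_digraph \<Rightarrow> 'a list \<Rightarrow> bool" where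
  "arrival_order G vs \<longleftrightarrow> distinct vs \<and> set vs = pverts G"

text \<open>
  Vertex arrival: the stream item of a vertex consists of its name and the set of its neighbours
  among the vertices that arrived before it.
\<close>

definition va_stream :: "'a pair_pre_digraph \<Rightarrow> 'a list \<Rightarrow> ('a \<times> 'a set) list" where
  "va_stream G vs =
     map (\<lambda>i. (vs ! i, {u \<in> set (take i vs). (u, vs ! i) \<in> parcs G})) [0..<length vs]"

text \<open>
  The memory content is a bit string.  The first argument of each component is the number of
  vertices, and the second argument of \<open>alg_step\<close> is the index of the current pass; both are
  available to the algorithm without being charged as memory.  The components are arbitrary
  functions, so computation is unlimited.
\<close>

record stream_alg =
  alg_init :: "nat \<Rightarrow> bool list"
  alg_step :: "nat \<Rightarrow> nat \<Rightarrow> bool list \<Rightarrow> nat \<times> nat set \<Rightarrow> bool list"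
  alg_answer :: "nat \<Rightarrow> bool list \<Rightarrow> bool"

definition passes :: "nat \<Rightarrow> 'b list \<Rightarrow> (nat \<times> 'b) list" where
  "passes p xs = concat (map (\<lambda>j. map (Pair j) xs) [0..<p])"

definition memory_after :: "stream_alg \<Rightarrow> nat \<Rightarrow> (nat \<times> nat \<times> nat set) list \<Rightarrow> bool list" where
  "memory_after A n w = foldl (\<lambda>m (j, x). alg_step A n j m x) (alg_init A n) w"

definition memory_used :: "stream_alg \<Rightarrow> nat \<Rightarrow> nat \<Rightarrow> (nat \<times> nat set) list \<Rightarrow> nat" where
  "memory_used A n p xs = (MAX w\<in>set (prefixes (passes p xs)). length (memory_after A n w))"

text \<open>The number of passes may depend on the number of vertices.\<close>

definition solves_connectivity ::
    "stream_alg \<Rightarrow> (nat \<Rightarrow> nat) \<Rightarrow> nat pair_pre_digraph set \<Rightarrow> bool" where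
  "solves_connectivity A p F \<longleftrightarrow>
     (\<forall>G\<in>F. \<forall>vs. arrival_order G vs \<longrightarrow>
        (let n = card (pverts G)
         in alg_answer A n (memory_after A n (passes (p n) (va_stream G vs)))
              \<longleftrightarrow> Digraph_Component.connected (with_proj G)))"

end

theory Submission
  imports Defs
begin

text \<open>
  Fooling set argument.  The first half of the stream consists of \<open>m\<close> vertices, of which consecutive
  ones \<open>i, i + 1\<close> are adjacent iff \<open>i \<in> X\<close>; the second half consists of one vertex per \<open>i\<close>, adjacent
  to \<open>i\<close> and, iff \<open>i \<in> Y\<close>, also to \<open>i + 1\<close>.  The graph is connected iff \<open>X \<union> Y\<close> covers all \<open>m - 1\<close>
  gaps, and the first (second) half of the stream depends on \<open>X\<close> (\<open>Y\<close>) only.  The memory contents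
  at the middle and at the end of all passes form a transcript; if \<open>(X, - X)\<close> and \<open>(X', - X')\<close> had
  equal transcripts, then \<open>(X, - X')\<close> and \<open>(X', - X)\<close> would have the same transcript as well and
  would both be accepted, which forces \<open>X = X'\<close>.  So there are at least \<open>2 ^ (m - 1)\<close> transcripts.
\<close>

section \<open>Multi-pass runs and their transcripts\<close>

lemma passes_0 [simp]: "passes 0 xs = []"
  and passes_Suc: "passes (Suc p) xs = passes p xs @ map (Pair p) xs"
  by (simp_all add: passes_def)

lemma memory_after_append:
  "memory_after A n (v @ w) = foldl (\<lambda>m (j, x). alg_step A n j m x) (memory_after A n v) w"
  by (simp add: memory_after_def)

lemma memory_after_append_cong:
  assumes "memory_after A n v = memory_after A n v'"
  shows "memory_after A n (v @ w) = memory_after A n (v' @ w)"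
  using assms by (simp add: memory_after_append)

lemma length_memory_after_le:
  assumes "prefix w (passes p xs)"
  shows "length (memory_after A n w) \<le> memory_used A n p xs"
  unfolding memory_used_def using assms by (intro Max_ge) auto

text \<open>This is the transcript of a two-party protocol: one party holds \<open>as\<close>, the
  other \<open>bs\<close>, and the memory is handed over twice per pass. The initial memory is
  omitted because it is the same for all inputs.\<close>

definition transcript ::
    "stream_alg \<Rightarrow> nat \<Rightarrow> nat \<Rightarrow> (nat \<times> nat set) list \<Rightarrow> (nat \<times> nat set) list \<Rightarrow> bool list list" where
  "transcript A n p as bs =
     map (\<lambda>j. memory_after A n (passes j (as @ bs) @ map (Pair j) as)) [0..<p] @
     map (\<lambda>j. memory_after A n (passes (Suc j) (as @ bs))) [0..<p]"

lemma length_transcript [simp]: "length (transcript A n p as bs) = 2 * p"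
  by (simp add: transcript_def)

lemma prefix_passes: "j \<le> p \<Longrightarrow> prefix (passes j xs) (passes p xs)"
  by (induction rule: dec_induct) (auto simp: passes_Suc intro: prefix_order.trans)

lemma length_transcript_elem_le:
  assumes "s \<in> set (transcript A n p as bs)"
  shows "length s \<le> memory_used A n p (as @ bs)"
proof -
  have fin: "prefix (passes (Suc j) (as @ bs)) (passes p (as @ bs))" if "j < p" for j
    using that by (intro prefix_passes) simp
  moreover have "prefix (passes j (as @ bs) @ map (Pair j) as) (passes (Suc j) (as @ bs))" for j
    by (simp add: passes_Suc)
  then have "prefix (passes j (as @ bs) @ map (Pair j) as) (passes p (as @ bs))" if "j < p" for j
    using fin that prefix_order.trans by blast
  ultimately show ?thesis
    using assms unfolding transcript_def by (auto intro!: length_memory_after_le)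
qed

text \<open>Rectangle property, by induction on the passes. If the mixed run starts a pass in the
  state of the run on \<open>as @ bs\<close>, reading \<open>as\<close> leads to the common middle
  state. From there \<open>bs'\<close> continues as in the run on \<open>as' @ bs'\<close>, up to
  the common final state of the pass.\<close>

lemma transcript_rectangle:
  assumes "transcript A n p as bs = transcript A n p as' bs'"
  shows "memory_after A n (passes p (as @ bs')) = memory_after A n (passes p (as @ bs))"
proof -
  from assms have mid: "memory_after A n (passes j (as @ bs) @ map (Pair j) as) =
      memory_after A n (passes j (as' @ bs') @ map (Pair j) as')"
    and fin: "memory_after A n (passes (Suc j) (as @ bs)) =
      memory_after A n (passes (Suc j) (as' @ bs'))" if "j < p" for j
    using that by (auto simp: transcript_def)
  have "memory_after A n (passes j (as @ bs')) = memory_after A n (passes j (as @ bs))"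
    if "j \<le> p" for j
    using that
  proof (induction j)
    case (Suc j)
    have "memory_after A n (passes j (as @ bs') @ map (Pair j) as) =
        memory_after A n (passes j (as' @ bs') @ map (Pair j) as')"
      using Suc mid[of j] by (simp add: memory_after_append)
    then have "memory_after A n ((passes j (as @ bs') @ map (Pair j) as) @ map (Pair j) bs') =
        memory_after A n ((passes j (as' @ bs') @ map (Pair j) as') @ map (Pair j) bs')"
      by (rule memory_after_append_cong)
    then show ?case
      using fin[of j] Suc.prems by (simp add: passes_Suc)
  qed simp
  then show ?thesis by simp
qed

section \<open>Counting bounded memory contents\<close>

lemma finite_bool_lists: "finite {s :: bool list. length s \<le> L}"
  using finite_lists_length_le[of "UNIV :: bool set" L] by simp

text \<open>The exponent is a pure multiple of \<open>L\<close>, exact at \<open>L = 0\<close>. A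
  bound such as \<open>2 ^ (L + 1)\<close> would leave an additive term in the final
  estimate.\<close>

lemma card_bool_lists: "card {s :: bool list. length s \<le> L} \<le> 2 ^ (2 * L)"
proof -
  have "card {s :: bool list. length s \<le> L} = (\<Sum>i\<le>L. 2 ^ i)"
    using card_lists_length_le[of "UNIV :: bool set" L] by simp
  also have "\<dots> \<le> 2 ^ (2 * L)"
  proof (induction L)
    case (Suc L)
    have "(2 :: nat) ^ L \<le> 2 ^ (2 * L)"
      by (rule power_increasing) simp_all
    moreover have "(\<Sum>i\<le>Suc L. 2 ^ i) = (\<Sum>i\<le>L. 2 ^ i) + 2 * (2 :: nat) ^ L"
      and "(2 :: nat) ^ (2 * Suc L) = 4 * 2 ^ (2 * L)"
      by simp_all
    ultimately show ?case using Suc by linarith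
  qed simp
  finally show ?thesis .
qed

section \<open>The fooling graphs\<close>

text \<open>Meant for \<open>u < v\<close>, so that \<open>v\<close> is the later arrival. Vertices
  below \<open>m\<close> are path vertices; vertex \<open>m + i\<close> is the connector of gap
  \<open>i\<close>, the gap between \<open>i\<close> and \<open>i + 1\<close>.\<close>

definition fool_edge :: "nat \<Rightarrow> nat set \<Rightarrow> nat set \<Rightarrow> nat \<Rightarrow> nat \<Rightarrow> bool" where
  "fool_edge m X Y u v \<longleftrightarrow>
     (if v < m then v = Suc u \<and> u \<in> X
      else u < m \<and> (u = v - m \<or> u = Suc (v - m) \<and> v - m \<in> Y))"

definition fool_graph :: "nat \<Rightarrow> nat \<Rightarrow> nat set \<Rightarrow> nat set \<Rightarrow> nat pair_pre_digraph" where
  "fool_graph n m X Y =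
     \<lparr>pverts = {..<n},
      parcs = {(u, v). u < n \<and> v < n \<and>
                 (u < v \<and> fool_edge m X Y u v \<or> v < u \<and> fool_edge m X Y v u)}\<rparr>"

definition fool_items :: "nat \<Rightarrow> nat set \<Rightarrow> nat set \<Rightarrow> nat list \<Rightarrow> (nat \<times> nat set) list" where
  "fool_items m X Y vs = map (\<lambda>v. (v, {u. u < v \<and> fool_edge m X Y u v})) vs"

lemma pverts_fool_graph [simp]: "pverts (fool_graph n m X Y) = {..<n}"
  by (simp add: fool_graph_def)

lemma in_parcs_fool_graph:
  "(u, v) \<in> parcs (fool_graph n m X Y) \<longleftrightarrow> u < n \<and> v < n \<and>
     (u < v \<and> fool_edge m X Y u v \<or> v < u \<and> fool_edge m X Y v u)"
  by (simp add: fool_graph_def)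

lemma pair_graph_fool_graph: "pair_graph (fool_graph n m X Y)"
proof unfold_locales
  have "parcs (fool_graph n m X Y) \<subseteq> {..<n} \<times> {..<n}"
    by (auto simp: in_parcs_fool_graph)
  then show "finite (parcs (fool_graph n m X Y))"
    by (rule finite_subset) simp
  show "symmetric (with_proj (fool_graph n m X Y))"
    by (auto simp: symmetric_def in_parcs_fool_graph intro: symI)
qed (auto simp: in_parcs_fool_graph)

lemma input_graph_fool_graph: "0 < n \<Longrightarrow> input_graph (fool_graph n m X Y)"
  using pair_graph_fool_graph by (auto simp: input_graph_def)

lemma interval_graph_fool_graph:
  assumes "n \<le> 2 * m"
  shows "interval_graph (fool_graph n m X Y)"
proof -
  \<comment> \<open>Path vertex \<open>i\<close> gets [2i, 2i+1], stretched to 2i+2, the left end of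
    its successor, iff \<open>i \<in> X\<close>. Connector \<open>m + i\<close> gets the point 2i+1,
    stretched to 2i+2 iff \<open>i \<in> Y\<close>.\<close>
  define lo :: "nat \<Rightarrow> nat" where "lo v = (if v < m then 2 * v else 2 * (v - m) + 1)" for v
  define hi :: "nat \<Rightarrow> nat" where
    "hi v = (if v < m then 2 * v + (if v \<in> X then 2 else 1)
             else 2 * (v - m) + (if v - m \<in> Y then 2 else 1))" for v
  define I :: "nat \<Rightarrow> real set" where "I v = {real (lo v)..real (hi v)}" for v
  have le: "lo v \<le> hi v" for v
    by (simp add: lo_def hi_def)
  have meet: "I u \<inter> I v \<noteq> {} \<longleftrightarrow> lo u \<le> hi v \<and> lo v \<le> hi u" for u v
    using le[of u] le[of v] by (auto simp: I_def)
  have edge: "fool_edge m X Y u v \<longleftrightarrow> lo u \<le> hi v \<and> lo v \<le> hi u" if "u < v" "v < n" for u v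
  proof -
    consider "v < m" | w where "u < m" "v = m + w" | w w' where "u = m + w'" "v = m + w"
      by (metis le_add_diff_inverse not_less)
    then show ?thesis
    proof cases
      case 1
      with that show ?thesis
        by (cases "u \<in> X"; cases "v \<in> X") (simp_all add: fool_edge_def lo_def hi_def; linarith)+
    next
      case 2
      with that show ?thesis
        by (cases "u \<in> X"; cases "w \<in> Y") (simp_all add: fool_edge_def lo_def hi_def; linarith)+
    next
      case 3
      with that show ?thesis
        by (simp add: fool_edge_def lo_def hi_def)
    qed
  qed
  have "parcs (fool_graph n m X Y) =
      {(u, v). u < n \<and> v < n \<and> u \<noteq> v \<and> I u \<inter> I v \<noteq> {}}"
    unfolding meet by (auto simp: in_parcs_fool_graph edge neq_iff)
  moreover have "is_interval (I v)" "I v \<noteq> {}" for v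
    using le[of v] by (auto simp: I_def is_interval_1)
  ultimately show ?thesis
    unfolding interval_graph_def by (intro conjI exI[of _ I]) simp_all
qed

lemma va_stream_upt:
  "va_stream G [0..<n] = map (\<lambda>v. (v, {u. u < v \<and> (u, v) \<in> parcs G})) [0..<n]"
  by (auto simp: va_stream_def)

text \<open>Earlier neighbours are governed by \<open>X\<close> for a path vertex and by
  \<open>Y\<close> for a connector. Putting \<open>{}\<close> for the other set makes this
  independence visible.\<close>

lemma va_stream_fool_graph:
  assumes "m \<le> n"
  shows "va_stream (fool_graph n m X Y) [0..<n] =
     fool_items m X {} [0..<m] @ fool_items m {} Y [m..<n]"
proof -
  have "[0..<n] = [0..<m] @ [m..<n]"
    using upt_add_eq_append[of 0 m "n - m"] assms by simp
  moreover have "va_stream (fool_graph n m X Y) [0..<n] = fool_items m X Y [0..<n]"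
    unfolding va_stream_upt fool_items_def by (auto simp: in_parcs_fool_graph)
  ultimately show ?thesis
    by (auto simp: fool_items_def fool_edge_def)
qed

text \<open>The library defines connectedness as strong connectedness of the symmetric closure, and
  a symmetric graph is its own closure.\<close>

lemma connected_symmetric_iff:
  assumes "symmetric (with_proj G)"
  shows "Digraph_Component.connected (with_proj G) \<longleftrightarrow> strongly_connected (with_proj G)"
proof -
  have "parcs (mk_symmetric (with_proj G)) = parcs G"
    using assms by (force simp: parcs_mk_symmetric symmetric_def dest: symD)
  then have "mk_symmetric (with_proj G) = G"
    by (simp add: pair_pre_digraph.equality)
  then show ?thesis
    by (simp add: Digraph_Component.connected_def)
qed

text \<open>The hypotheses say that \<open>n\<close> is \<open>2 * m\<close> or
  \<open>2 * m - 1\<close>, so each of the \<open>m - 1\<close> gaps has its connector.\<close>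

lemma connected_fool_graph_iff:
  assumes "0 < m" "m \<le> n" "n \<le> 2 * m" "2 * m \<le> Suc n"
  shows "Digraph_Component.connected (with_proj (fool_graph n m X Y)) \<longleftrightarrow> {..<m - 1} \<subseteq> X \<union> Y"
proof -
  define G where "G = fool_graph n m X Y"
  interpret G: pair_graph G
    unfolding G_def by (rule pair_graph_fool_graph)
  have arc: "(u, v) \<in> parcs G \<longleftrightarrow> u < n \<and> v < n \<and>
     (u < v \<and> fool_edge m X Y u v \<or> v < u \<and> fool_edge m X Y v u)" for u v
    by (simp add: G_def in_parcs_fool_graph)
  have verts: "pverts G = {..<n}"
    by (simp add: G_def)
  note conn = connected_symmetric_iff[OF G.pair_sym_arcs]
  have "{..<m - 1} \<subseteq> X \<union> Y" if "strongly_connected (with_proj G)"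
  proof (rule ccontr)
    assume "\<not> {..<m - 1} \<subseteq> X \<union> Y"
    then obtain i where i: "i < m - 1" "i \<notin> X" "i \<notin> Y"
      by auto
    have "0 \<rightarrow>\<^sup>*\<^bsub>with_proj G\<^esub> Suc i"
      using that i assms verts by (auto simp: strongly_connected_def)
    \<comment> \<open>This is the side of gap \<open>i\<close> that contains 0: path vertices up to
      \<open>i\<close> and connectors up to \<open>m + i\<close>. No arc leaves it when
      \<open>i\<close> is in neither set.\<close>
    moreover have "v \<le> i \<or> m \<le> v \<and> v \<le> m + i" if "0 \<rightarrow>\<^sup>*\<^bsub>with_proj G\<^esub> v" for v
      using that
    proof (induction rule: G.reachable_induct)
      case (step u v)
      then have "(u, v) \<in> parcs G" by simp
      then show ?case
        using step.IH i unfolding arc fool_edge_def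
        by (auto split: if_splits)
          (metis Suc_leI le_neq_implies_less le_diff_conv add.commute)+
    qed simp
    ultimately have "Suc i \<le> i \<or> m \<le> Suc i \<and> Suc i \<le> m + i"
      by blast
    with i show False by linarith
  qed
  moreover have "strongly_connected (with_proj G)" if cov: "{..<m - 1} \<subseteq> X \<union> Y"
  proof -
    have sym: "v \<rightarrow>\<^sup>*\<^bsub>with_proj G\<^esub> u" if "u \<rightarrow>\<^sup>*\<^bsub>with_proj G\<^esub> v" for u v
      using that G.pair_sym_arcs by (rule symmetric_reachable[rotated])
    have path: "0 \<rightarrow>\<^sup>*\<^bsub>with_proj G\<^esub> i" if "i < m" for i
      using that
    proof (induction i)
      case 0
      then show ?case using assms verts by auto
    next
      case (Suc i)
      then have IH: "0 \<rightarrow>\<^sup>*\<^bsub>with_proj G\<^esub> i" by simp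
      show ?case
      proof (cases "i \<in> X")
        case True
        then have "(i, Suc i) \<in> parcs G"
          using Suc.prems assms by (auto simp: arc fool_edge_def)
        then show ?thesis using IH by (auto intro: G.reachable_adj_trans)
      next
        case False
        moreover have "i \<in> {..<m - 1}" using Suc.prems by auto
        ultimately have "i \<in> Y" using cov by blast
        \<comment> \<open>A gap missing from \<open>X\<close> is crossed by a detour through its
          connector; \<open>2 * m \<le> Suc n\<close> guarantees \<open>m + i < n\<close>.\<close>
        then have "(i, m + i) \<in> parcs G" "(m + i, Suc i) \<in> parcs G"
          using Suc.prems assms by (auto simp: arc fool_edge_def)
        then show ?thesis using IH by (auto intro: G.reachable_adj_trans)
      qed
    qed
    have "0 \<rightarrow>\<^sup>*\<^bsub>with_proj G\<^esub> v" if "v < n" for v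
    proof (cases "v < m")
      case False
      then have "(v - m, v) \<in> parcs G" "v - m < m"
        using that assms by (auto simp: arc fool_edge_def)
      then show ?thesis using path[of "v - m"] by (auto intro: G.reachable_adj_trans)
    qed (rule path)
    then have "u \<rightarrow>\<^sup>*\<^bsub>with_proj G\<^esub> v" if "u < n" "v < n" for u v
      using that G.reachable_trans[OF sym[of 0 u], of v] by blast
    moreover have "0 \<in> pverts G"
      using assms verts by simp
    ultimately show ?thesis
      unfolding strongly_connected_def by (metis empty_iff lessThan_iff verts with_proj_simps(1))
  qed
  ultimately show ?thesis
    using conn unfolding G_def by blast
qed

section \<open>The lower bound\<close>

lemma memory_lower_bound:
  assumes interval: "\<And>G. input_graph G \<Longrightarrow> interval_graph G \<Longrightarrow> G \<in> F"
    and solves: "solves_connectivity A p F"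
    and m: "0 < m" "m \<le> n" "n \<le> 2 * m" "2 * m \<le> Suc n"
  obtains X where "m - 1 \<le> 4 * memory_used A n (p n) (va_stream (fool_graph n m X (- X)) [0..<n]) * p n"
proof -
  define as where "as X = fool_items m X {} [0..<m]" for X
  define bs where "bs Y = fool_items m {} Y [m..<n]" for Y
  have stream: "va_stream (fool_graph n m X Y) [0..<n] = as X @ bs Y" for X Y
    using va_stream_fool_graph[OF m(2)] by (simp add: as_def bs_def)
  have answer: "alg_answer A n (memory_after A n (passes (p n) (as X @ bs Y))) \<longleftrightarrow>
      {..<m - 1} \<subseteq> X \<union> Y" for X Y
  proof -
    have "fool_graph n m X Y \<in> F"
      using interval input_graph_fool_graph interval_graph_fool_graph m by simp
    moreover have "arrival_order (fool_graph n m X Y) [0..<n]"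
      by (auto simp: arrival_order_def)
    ultimately show ?thesis
      using solves connected_fool_graph_iff[OF m, of X Y]
      unfolding solves_connectivity_def Let_def by (metis card_lessThan pverts_fool_graph stream)
  qed
  define T where "T X = transcript A n (p n) (as X) (bs (- X))" for X
  \<comment> \<open>The mixed input \<open>(X', - X)\<close> gets the same answer as
    \<open>(X', - X')\<close>, which is accepted. Exchanging the roles of the two sets gives
    injectivity of \<open>T\<close>.\<close>
  have sub: "X \<subseteq> X'" if "T X = T X'" "X \<subseteq> {..<m - 1}" for X X'
  proof -
    have "memory_after A n (passes (p n) (as X' @ bs (- X))) =
        memory_after A n (passes (p n) (as X' @ bs (- X')))"
      using that(1) transcript_rectangle unfolding T_def by metis
    then have "{..<m - 1} \<subseteq> X' \<union> - X"
      using answer[of X' "- X"] answer[of X' "- X'"] by simp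
    then show ?thesis using that(2) by blast
  qed
  define mem where "mem X = memory_used A n (p n) (as X @ bs (- X))" for X
  \<comment> \<open>Taking the worst case over all inputs bounds every transcript entry by
    \<open>L\<close> bits, and a maximiser is the input to be exhibited.\<close>
  define L where "L = Max (mem ` Pow {..<m - 1})"
  have "L \<in> mem ` Pow {..<m - 1}"
    unfolding L_def by (intro Max_in) auto
  then obtain X where X: "L = mem X"
    by auto
  have mem_le: "mem X \<le> L" if "X \<subseteq> {..<m - 1}" for X
    unfolding L_def using that by (intro Max_ge) auto
  let ?S = "{s :: bool list. length s \<le> L}"
  have "inj_on T (Pow {..<m - 1})"
    by (intro inj_onI) (metis sub PowD subset_antisym)
  moreover have "T ` Pow {..<m - 1} \<subseteq> {ts. set ts \<subseteq> ?S \<and> length ts = 2 * p n}"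
  proof clarify
    fix X
    assume "X \<subseteq> {..<m - 1}"
    then have "length s \<le> L" if "s \<in> set (T X)" for s
      using that mem_le[of X] length_transcript_elem_le[of s A n "p n" "as X" "bs (- X)"]
      unfolding T_def mem_def by linarith
    then show "set (T X) \<subseteq> ?S \<and> length (T X) = 2 * p n"
      by (auto simp: T_def)
  qed
  moreover have "finite {ts. set ts \<subseteq> ?S \<and> length ts = 2 * p n}"
    by (intro finite_lists_length_eq finite_bool_lists)
  ultimately have "card (Pow {..<m - 1}) \<le> card {ts. set ts \<subseteq> ?S \<and> length ts = 2 * p n}"
    by (rule card_inj_on_le)
  also have "\<dots> = card ?S ^ (2 * p n)"
    by (intro card_lists_length_eq finite_bool_lists)
  also have "\<dots> \<le> (2 ^ (2 * L)) ^ (2 * p n)"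
    by (intro power_mono card_bool_lists) simp
  also have "\<dots> = 2 ^ (4 * L * p n)"
    by (simp add: power_mult[symmetric])
  finally have "(2 :: nat) ^ (m - 1) \<le> 2 ^ (4 * L * p n)"
    by (simp add: card_Pow)
  then have "m - 1 \<le> 4 * L * p n"
    by simp
  with X show thesis
    by (intro that[of X]) (simp add: stream mem_def)
qed

theorem theorem37:
  shows "\<exists>c::real. c > 0 \<and> (\<exists>N::nat.
    \<forall>(F :: nat pair_pre_digraph set) (A :: stream_alg) (p :: nat \<Rightarrow> nat).
      (\<forall>G\<in>F. input_graph G) \<and>
      (\<forall>G. input_graph G \<and> interval_graph G \<longrightarrow> G \<in> F) \<and>
      (\<forall>n. p n > 0) \<and>
      solves_connectivity A p F \<longrightarrow>
      (\<forall>n\<ge>N. \<exists>G\<in>F. \<exists>vs.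
         card (pverts G) = n \<and> arrival_order G vs \<and>
         real (memory_used A n (p n) (va_stream G vs)) \<ge> c * (real n / real (p n))))"
\<comment> \<open>The constant 16 combines the 4 of \<open>memory_lower_bound\<close> with the 4 in
  \<open>n \<le> 4 * (m - 1)\<close>; the latter needs \<open>n \<ge> 3\<close>.\<close>
proof (intro exI[of _ "1 / 16"] exI[of _ 3] conjI allI impI; (elim conjE)?)
  fix F :: "nat pair_pre_digraph set" and A p and n :: nat
  assume F: "\<forall>G. input_graph G \<and> interval_graph G \<longrightarrow> G \<in> F" and p: "\<forall>n. p n > 0"
    and solves: "solves_connectivity A p F" and n: "3 \<le> n"
  \<comment> \<open>Rounding \<open>n / 2\<close> up treats both parities of \<open>n\<close> at
    once.\<close>
  define m where "m = Suc n div 2"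
  have m: "0 < m" "m \<le> n" "n \<le> 2 * m" "2 * m \<le> Suc n" "n \<le> 4 * (m - 1)"
    using n unfolding m_def by presburger+
  obtain X where X:
    "m - 1 \<le> 4 * memory_used A n (p n) (va_stream (fool_graph n m X (- X)) [0..<n]) * p n"
    using memory_lower_bound[OF _ solves m(1-4)] F by blast
  let ?G = "fool_graph n m X (- X)"
  let ?M = "memory_used A n (p n) (va_stream ?G [0..<n])"
  have "n \<le> 16 * (?M * p n)"
    using X m(5) by linarith
  then have "real n \<le> 16 * (real ?M * real (p n))"
    by (metis of_nat_le_iff of_nat_mult of_nat_numeral)
  then have "1 / 16 * (real n / real (p n)) \<le> real ?M"
    using p by (simp add: divide_le_eq mult_ac)
  moreover have "?G \<in> F"
    using F m n by (simp add: input_graph_fool_graph interval_graph_fool_graph)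
  moreover have "arrival_order ?G [0..<n]"
    by (auto simp: arrival_order_def)
  ultimately show "\<exists>G\<in>F. \<exists>vs. card (pverts G) = n \<and> arrival_order G vs \<and>
      1 / 16 * (real n / real (p n)) \<le> real (memory_used A n (p n) (va_stream G vs))"
    by (intro bexI[of _ ?G] exI[of _ "[0..<n]"]) auto
qed simp

end
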